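(* Let $H$ be a normal subgroup of a finite group $G$. If the quotient group $G/H$ is a cyclic group of order $n\geq 4$, and $|H|\geq 3$, then $G$ is not stable.
   Context: Let $G$ be a finite group and let $A\subseteq G$ be a non-empty subset. A non-empty subset $B\subseteq G$ is called a (right) $s$-factor of $G$ associated with $A$ if every element $x\in AB=\{ab\mid a\in A,\ b\in B\}$ can be written uniquely as $x=ab$ with $a\in A$, $b\in B$, and $B$ is maximal with respect to inclusion among subsets with this property. The upper index $|G:A|^+$ and lower index $|G:A|^-$ are the sizes of a largest and of a smallest right $s$-factor of $G$ associated with $A$, respectively. The subset $A$ is called (right) stable in $G$ if $|G:A|^+=|G:A|^-$. The group $G$ is called (right) stable if all its non-empty subsets are right stable. *)

theory Defs
  imports "HOL-Algebra.Elementary_Groups"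
begin

definition unique_products :: "('a, 'b) monoid_scheme \<Rightarrow> 'a set \<Rightarrow> 'a set \<Rightarrow> bool" where
  "unique_products G A B \<longleftrightarrow>
     (\<forall>x \<in> A <#>\<^bsub>G\<^esub> B. \<exists>!p. p \<in> A \<times> B \<and> x = fst p \<otimes>\<^bsub>G\<^esub> snd p)"

definition right_s_factor :: "('a, 'b) monoid_scheme \<Rightarrow> 'a set \<Rightarrow> 'a set \<Rightarrow> bool" where
  "right_s_factor G A B \<longleftrightarrow>
     B \<noteq> {} \<and> B \<subseteq> carrier G \<and> unique_products G A B \<and>
     (\<forall>C. B \<subseteq> C \<and> C \<subseteq> carrier G \<and> unique_products G A C \<longrightarrow> C = B)"

(* In a finite group every non-empty A has a right s-factor (each singleton extends to one),
   so Max and Min below range over a finite non-empty set of sizes. *)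

definition upper_index :: "('a, 'b) monoid_scheme \<Rightarrow> 'a set \<Rightarrow> nat" where
  "upper_index G A = Max (card ` {B. right_s_factor G A B})"

definition lower_index :: "('a, 'b) monoid_scheme \<Rightarrow> 'a set \<Rightarrow> nat" where
  "lower_index G A = Min (card ` {B. right_s_factor G A B})"

definition right_stable_subset :: "('a, 'b) monoid_scheme \<Rightarrow> 'a set \<Rightarrow> bool" where
  "right_stable_subset G A \<longleftrightarrow> upper_index G A = lower_index G A"

definition right_stable_group :: "('a, 'b) monoid_scheme \<Rightarrow> bool" where
  "right_stable_group G \<longleftrightarrow>
     (\<forall>A. A \<noteq> {} \<and> A \<subseteq> carrier G \<longrightarrow> right_stable_subset G A)"

end

theory Submission
  imports Defs "HOL-Algebra.Multiplicative_Group"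
begin

text \<open>
  \<open>B\<close> is a right \<open>s\<close>-factor associated with \<open>A\<close> iff it is a maximal independent set of the Cayley
  graph in which distinct \<open>b, b'\<close> are adjacent when \<open>b' b\<inverse> \<in> A\<inverse> A\<close>. Let \<open>x\<close> map to a generator of
  \<open>G/H\<close> and take \<open>A = {1} \<union> (H - {1}) x\<close>. Since \<open>card H \<ge> 3\<close>, the set \<open>A\<inverse> A\<close> is
  \<open>x\<inverse> H \<union> H \<union> H x\<close> without \<open>x\<close> and \<open>x\<inverse>\<close>: each coset of \<open>H\<close> is a clique, and
  between cyclically consecutive cosets \<open>b\<close> misses only \<open>x b\<close>.
  The chain \<open>1, x, \<dots>, x\<^sup>n\<^sup>-\<^sup>2\<close> is independent, so some \<open>s\<close>-factor has at least \<open>n - 1\<close> elements.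
  On the other hand, leaving out the two cosets \<open>H\<close> and \<open>H x\<^sup>2\<close> and choosing \<open>x\<close> in \<open>H x\<close> and
  a chain starting at \<open>a x\<^sup>3\<close> through the remaining \<open>n - 3\<close> cosets gives an independent set
  which is already maximal if \<open>a \<in> H\<close> avoids \<open>1\<close> and \<open>x\<^sup>-\<^sup>n\<close>.
\<close>

section \<open>Collisions of translates and s-factors in an arbitrary group\<close>

context group
begin

text \<open>Once \<open>b = b'\<close> is known, \<open>a = a'\<close> follows by right
  cancellation. So the condition is pairwise in \<open>B\<close>: the translates of \<open>A\<close>
  by distinct elements of \<open>B\<close> are disjoint.\<close>

lemma unique_products_iff:
  assumes "A \<subseteq> carrier G" "B \<subseteq> carrier G"
  shows "unique_products G A B \<longleftrightarrow>
    (\<forall>a\<in>A. \<forall>a'\<in>A. \<forall>b\<in>B. \<forall>b'\<in>B. a \<otimes> b = a' \<otimes> b' \<longrightarrow> b = b')"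
proof
  assume unique: "unique_products G A B"
  show "\<forall>a\<in>A. \<forall>a'\<in>A. \<forall>b\<in>B. \<forall>b'\<in>B. a \<otimes> b = a' \<otimes> b' \<longrightarrow> b = b'"
  proof (intro ballI impI)
    fix a a' b b'
    assume h: "a \<in> A" "a' \<in> A" "b \<in> B" "b' \<in> B" "a \<otimes> b = a' \<otimes> b'"
    then have "a \<otimes> b \<in> A <#> B"
      by (auto simp: set_mult_def)
    then have "\<exists>!p. p \<in> A \<times> B \<and> a \<otimes> b = fst p \<otimes> snd p"
      using unique unfolding unique_products_def by (rule bspec[rotated])
    then obtain p where "\<And>q. q \<in> A \<times> B \<Longrightarrow> a \<otimes> b = fst q \<otimes> snd q \<Longrightarrow> q = p"
      by (elim ex1E) blast
    from this[of "(a, b)"] this[of "(a', b')"] have "(a, b) = (a', b')"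
      using h by simp
    then show "b = b'" by simp
  qed
next
  assume inj: "\<forall>a\<in>A. \<forall>a'\<in>A. \<forall>b\<in>B. \<forall>b'\<in>B. a \<otimes> b = a' \<otimes> b' \<longrightarrow> b = b'"
  show "unique_products G A B"
    unfolding unique_products_def
  proof
    fix y assume "y \<in> A <#> B"
    then obtain a b where ab: "a \<in> A" "b \<in> B" "y = a \<otimes> b"
      by (auto simp: set_mult_def)
    show "\<exists>!p. p \<in> A \<times> B \<and> y = fst p \<otimes> snd p"
    proof (rule ex1I[of _ "(a, b)"])
      fix p assume "p \<in> A \<times> B \<and> y = fst p \<otimes> snd p"
      moreover obtain a' b' where "p = (a', b')" by (cases p)
      ultimately have p: "p = (a', b')" "a' \<in> A" "b' \<in> B" "a \<otimes> b = a' \<otimes> b'"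
        using ab by auto
      then have "b = b'" using inj ab by blast
      moreover have "a = a'"
        using p ab assms \<open>b = b'\<close> by (metis right_cancel subsetD)
      ultimately show "p = (a, b)" using p by simp
    qed (use ab in auto)
  qed
qed

lemma unique_products_extends_to_s_factor:
  assumes "finite (carrier G)" "B \<noteq> {}" "B \<subseteq> carrier G" "unique_products G A B"
  obtains C where "B \<subseteq> C" "right_s_factor G A C"
proof -
  let ?\<F> = "{C. C \<subseteq> carrier G \<and> unique_products G A C}"
  have "finite ?\<F>"
    by (rule finite_subset[of _ "Pow (carrier G)"]) (use assms(1) in auto)
  moreover have "B \<in> ?\<F>" using assms by simp
  ultimately obtain C where C: "C \<in> ?\<F>" "B \<subseteq> C" "\<forall>D\<in>?\<F>. C \<subseteq> D \<longrightarrow> C = D"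
    using finite_has_maximal2 by meson
  have "right_s_factor G A C"
    unfolding right_s_factor_def using C assms(2) by blast
  with C(2) show thesis by (rule that)
qed

text \<open>Independent and dominating implies maximal: any \<open>g\<close> in a larger independent
  \<open>C\<close> collides with some \<open>b\<close> in \<open>B\<close>, and both lie in
  \<open>C\<close>, so \<open>g = b\<close>.\<close>

lemma right_s_factorI:
  assumes "A \<subseteq> carrier G" "B \<noteq> {}" "B \<subseteq> carrier G" "unique_products G A B"
    and dominating: "\<And>g. g \<in> carrier G \<Longrightarrow> \<exists>b\<in>B. \<exists>a\<in>A. \<exists>a'\<in>A. a \<otimes> b = a' \<otimes> g"
  shows "right_s_factor G A B"
  unfolding right_s_factor_def
proof (intro conjI allI impI)
  fix C assume C: "B \<subseteq> C \<and> C \<subseteq> carrier G \<and> unique_products G A C"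
  have "g \<in> B" if "g \<in> C" for g
  proof -
    from that C dominating obtain b a a' where "b \<in> B" "a \<in> A" "a' \<in> A" "a \<otimes> b = a' \<otimes> g"
      by blast
    moreover from this have "b = g"
      using unique_products_iff[of A C] assms(1) C that by blast
    ultimately show ?thesis by simp
  qed
  with C show "C = B" by blast
qed (use assms(1-4) in auto)

lemma not_right_stable_groupI:
  assumes "finite (carrier G)" "A \<noteq> {}" "A \<subseteq> carrier G"
    and "right_s_factor G A B" "right_s_factor G A C" "card B < card C"
  shows "\<not> right_stable_group G"
proof
  assume stable: "right_stable_group G"
  let ?S = "card ` {B. right_s_factor G A B}"
  have "finite {B. right_s_factor G A B}"
    by (rule finite_subset[of _ "Pow (carrier G)"]) (use assms(1) in \<open>auto simp: right_s_factor_def\<close>)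
  then have "Min ?S \<le> card B" "card C \<le> Max ?S"
    using assms by (auto intro: Min_le Max_ge)
  moreover have "Max ?S = Min ?S"
    using stable assms(2,3)
    by (auto simp: right_stable_group_def right_stable_subset_def upper_index_def lower_index_def)
  ultimately show False using assms(6) by linarith
qed

section \<open>Integer coordinates for a cyclic quotient\<close>

lemma cyclic_group_iso_integer_mod_group:
  assumes "cyclic_group G" "order G = n" "n > 0"
  obtains f q where "f \<in> iso G (integer_mod_group n)" "q \<in> carrier G" "f q = 1 mod int n"
proof -
  from assms(1) obtain q where q: "q \<in> carrier G" "carrier G = range (\<lambda>k::int. q [^] k)"
    using cyclic_group by auto
  have "generate G {q} = carrier G"
    using generate_pow[OF q(1)] q(2) by auto
  then have ord: "ord q = n"
    using generate_pow_card[OF q(1)] assms(2) by (simp add: order_def)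
  have pow_eq: "q [^] k = q [^] l \<longleftrightarrow> k mod int n = l mod int n" for k l :: int
    using int_pow_eq[OF q(1)] ord by (metis mod_eq_dvd_iff)
  define h where "h = (\<lambda>k::int. q [^] k)"
  have "h \<in> hom (integer_mod_group n) G"
  proof (rule homI)
    fix k l
    have "h (k \<otimes>\<^bsub>integer_mod_group n\<^esub> l) = q [^] (k + l)"
      using pow_eq by (simp add: h_def)
    also have "\<dots> = h k \<otimes> h l"
      using q(1) by (simp add: h_def int_pow_mult)
    finally show "h (k \<otimes>\<^bsub>integer_mod_group n\<^esub> l) = h k \<otimes> h l" .
  qed (use q in \<open>auto simp: h_def\<close>)
  moreover have "inj_on h (carrier (integer_mod_group n))"
    using assms(3) pow_eq by (auto simp: inj_on_def h_def carrier_integer_mod_group)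
  moreover have "h ` carrier (integer_mod_group n) = carrier G"
  proof -
    have "q [^] k \<in> h ` carrier (integer_mod_group n)" for k :: int
      using assms(3) pow_eq[of k "k mod int n"]
      by (intro image_eqI[of _ _ "k mod int n"]) (auto simp: h_def carrier_integer_mod_group)
    then show ?thesis using q by (auto simp: h_def)
  qed
  ultimately have h: "h \<in> iso (integer_mod_group n) G"
    by (simp add: iso_def bij_betw_def)
  let ?f = "inv_into (carrier (integer_mod_group n)) h"
  have "?f \<in> iso G (integer_mod_group n)"
    using h by (simp add: group.iso_set_sym)
  \<comment> \<open>The residue is written \<open>1 mod int n\<close> because for
    \<open>n = 1\<close> the generator goes to 0.\<close>
  moreover have "?f q = 1 mod int n"
  proof (rule inv_into_f_eq)
    show "h (1 mod int n) = q"
      using pow_eq[of "1 mod int n" 1] q(1) by (simp add: h_def int_pow_1)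
  qed (use h assms(3) in \<open>auto simp: iso_def bij_betw_def carrier_integer_mod_group\<close>)
  ultimately show thesis using that q(1) by blast
qed

text \<open>Compose the quotient map with an isomorphism onto the residues and let \<open>x\<close>
  represent a generating coset. Cosets of \<open>H\<close> become the level sets of
  \<open>c\<close>, so coset bookkeeping turns into integer arithmetic.\<close>

lemma cyclic_quotient_coordinate:
  assumes "H \<lhd> G" "cyclic_group (G Mod H)" "order (G Mod H) = n" "n > 0"
  obtains c x where "c \<in> hom G (integer_mod_group n)" "kernel G (integer_mod_group n) c = H"
    "x \<in> carrier G" "c x = 1 mod int n"
proof -
  interpret N: normal H G by fact
  interpret Q: group "G Mod H" by (rule N.factorgroup_is_group)
  obtain f q where f: "f \<in> iso (G Mod H) (integer_mod_group n)"
    and q: "q \<in> carrier (G Mod H)" "f q = 1 mod int n"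
    using Q.cyclic_group_iso_integer_mod_group assms by metis
  obtain x where x: "x \<in> carrier G" "q = H #> x"
    using q(1) by (auto simp: FactGroup_def RCOSETS_def)
  interpret f: group_hom "G Mod H" "integer_mod_group n" f
    using f by (simp add: group_hom_def group_hom_axioms_def iso_def)
  define c where "c = f \<circ> (\<lambda>g. H #> g)"
  have "c \<in> hom G (integer_mod_group n)"
    unfolding c_def using N.r_coset_hom_Mod f.homh by (rule Group.hom_compose)
  moreover have "kernel G (integer_mod_group n) c = H"
  proof -
    have "c g = 0 \<longleftrightarrow> g \<in> H" if "g \<in> carrier G" for g
    proof -
      have "inj_on f (carrier (G Mod H))"
        using f by (simp add: iso_def bij_betw_def)
      moreover have "H #> g \<in> carrier (G Mod H)"
        using that by (auto simp: FactGroup_def RCOSETS_def)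
      moreover have "f H = 0" "H \<in> carrier (G Mod H)"
        using f.hom_one Q.one_closed by simp_all
      ultimately have "c g = 0 \<longleftrightarrow> H #> g = H"
        unfolding c_def by (metis comp_apply inj_on_eq_iff)
      also have "\<dots> \<longleftrightarrow> g \<in> H"
        using that N.subgroup_axioms coset_join1 coset_join2 by (metis N.subset)
      finally show ?thesis .
    qed
    then show ?thesis using N.subset by (auto simp: kernel_def)
  qed
  ultimately show thesis using that x q by (simp add: c_def)
qed

end

section \<open>Arithmetic of the coset coordinate\<close>

locale cyclic_coordinate = group G for G (structure) +
  fixes n :: nat and c :: "'a \<Rightarrow> int" and x :: 'a
  assumes n_ge: "n \<ge> 4"
    and c_hom: "c \<in> hom G (integer_mod_group n)"
    and x_closed [simp]: "x \<in> carrier G"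
    and c_x [simp]: "c x = 1"
    and card_kernel: "card (kernel G (integer_mod_group n) c) \<ge> 3"
begin

sublocale c: group_hom G "integer_mod_group n" c
  using c_hom by (simp add: group_hom_def group_hom_axioms_def)

declare c.hom_inv [simp del]

lemma c_range: "g \<in> carrier G \<Longrightarrow> 0 \<le> c g \<and> c g < int n"
  using c.hom_closed[of g] n_ge by (auto simp: carrier_integer_mod_group)

lemma c_mult [simp]: "g \<in> carrier G \<Longrightarrow> h \<in> carrier G \<Longrightarrow> c (g \<otimes> h) = (c g + c h) mod int n"
  using c.hom_mult by simp

lemma c_inv [simp]: "g \<in> carrier G \<Longrightarrow> c (inv g) = (- c g) mod int n"
  using c.hom_inv c.hom_closed by simp

lemma c_pow: "c (x [^] (i::nat)) = int i mod int n"
  using c.hom_nat_pow by simp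

text \<open>Both coordinates lie in \<open>0..n - 1\<close>, so a single wrap-around suffices. The
  form without \<open>mod\<close> suits linear arithmetic.\<close>

lemma c_diff:
  assumes "g \<in> carrier G" "h \<in> carrier G"
  shows "c (g \<otimes> inv h) = (if c h \<le> c g then c g - c h else c g - c h + int n)"
proof -
  have "c (g \<otimes> inv h) = (c g - c h) mod int n"
    using assms by (simp add: mod_add_right_eq)
  then show ?thesis
    using c_range[OF assms(1)] c_range[OF assms(2)] mod_add_self2[of "c g - c h" "int n"]
    by (auto simp: mod_pos_pos_trivial simp del: mod_add_self2)
qed

lemma c_inv_eq: "g \<in> carrier G \<Longrightarrow> c (inv g) = (if c g = 0 then 0 else int n - c g)"
  using c_diff[of \<one> g] c_range[of g] c.hom_one by auto

lemma neq_x: "c d = k \<Longrightarrow> k \<noteq> 1 \<Longrightarrow> d \<noteq> x"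
  using c_x by blast

lemma neq_inv_x: "c d = k \<Longrightarrow> k \<noteq> int n - 1 \<Longrightarrow> d \<noteq> inv x"
  using c_inv_eq[OF x_closed] by auto

text \<open>Here \<open>card H \<ge> 3\<close> enters. It is needed for two choices:
  \<open>h\<close> in \<open>D_connects\<close> and \<open>a\<close> in
  \<open>small_s_factor\<close>.\<close>

lemma kernel_avoids_two: "\<exists>a\<in>carrier G. c a = 0 \<and> a \<noteq> u \<and> a \<noteq> v"
proof (rule ccontr)
  assume "\<not> ?thesis"
  then have "kernel G (integer_mod_group n) c \<subseteq> {u, v}"
    by (auto simp: kernel_def)
  then have "card (kernel G (integer_mod_group n) c) \<le> card {u, v}"
    by (rule card_mono[rotated]) simp
  also have "\<dots> \<le> 2" by (simp add: card_insert_if)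
  finally show False using card_kernel by simp
qed

section \<open>The set \<open>A\<close> and its Cayley graph\<close>

definition A :: "'a set" where
  "A = insert \<one> {g \<in> carrier G. c g = 1 \<and> g \<noteq> x}"

lemma A_subset: "A \<subseteq> carrier G"
  by (auto simp: A_def)

text \<open>This is \<open>A\<inverse> A\<close>, as the next two lemmas show, one inclusion each.
  The value \<open>int n - 1\<close> stands for -1.\<close>

definition D :: "'a set" where
  "D = {d \<in> carrier G. c d \<in> {0, 1, int n - 1} \<and> d \<noteq> x \<and> d \<noteq> inv x}"

lemma inv_mult_in_D:
  assumes "a \<in> A" "a' \<in> A"
  shows "inv a' \<otimes> a \<in> D"
proof -
  have neq: "d \<noteq> x \<and> d \<noteq> inv x" if "c d = 0" for d
    using neq_x[OF that] neq_inv_x[OF that] n_ge by simp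
  consider "a' = \<one>" "a = \<one>" | "a' = \<one>" "c a = 1" "a \<noteq> x" "a \<in> carrier G"
    | "a = \<one>" "c a' = 1" "a' \<noteq> x" "a' \<in> carrier G"
    | "c a = 1" "c a' = 1" "a \<in> carrier G" "a' \<in> carrier G"
    using assms by (auto simp: A_def)
  then show ?thesis
  proof cases
    case 1
    then show ?thesis using neq[of \<one>] c.hom_one by (simp add: D_def)
  next
    case 2
    then have "a \<noteq> inv x" using neq_inv_x[of a 1] n_ge by simp
    with 2 show ?thesis by (simp add: D_def)
  next
    case 3
    have c': "c (inv a') = int n - 1" using c_inv_eq[of a'] 3 n_ge by simp
    have "inv a' \<noteq> x" by (rule neq_x[OF c']) (use n_ge in simp)
    moreover have "inv a' \<noteq> inv x" using 3 inv_inj[THEN inj_onD] x_closed by metis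
    ultimately show ?thesis using 3 c' by (simp add: D_def del: c_inv)
  next
    case 4
    then have "c (inv a' \<otimes> a) = 0"
      by (simp add: mod_add_left_eq)
    then show ?thesis using neq[of "inv a' \<otimes> a"] 4 by (simp add: D_def del: c_mult)
  qed
qed

lemma D_connects:
  assumes "d \<in> D"
  shows "\<exists>a\<in>A. \<exists>a'\<in>A. a = a' \<otimes> d"
proof -
  have d: "d \<in> carrier G" "d \<noteq> x" "d \<noteq> inv x" using assms by (auto simp: D_def)
  consider "c d = 0" | "c d = 1" | "c d = int n - 1" using assms by (auto simp: D_def)
  then show ?thesis
  proof cases
    case 1
    \<comment> \<open>The witnesses will be \<open>a' = h \<otimes> x\<close> and
      \<open>a = h \<otimes> x \<otimes> d\<close>. Both have coordinate 1, and the two values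
      forbidden for \<open>h\<close> are those making one of them equal to \<open>x\<close>.\<close>
    obtain h where h: "h \<in> carrier G" "c h = 0" "h \<noteq> \<one>" "h \<noteq> x \<otimes> inv (x \<otimes> d)"
      using kernel_avoids_two by blast
    have "c (h \<otimes> x) = 1" "c (h \<otimes> x \<otimes> d) = 1"
      using h d 1 n_ge by simp_all
    moreover have "h \<otimes> x \<noteq> x"
      using h r_cancel_one by simp
    moreover have "h \<otimes> x \<otimes> d \<noteq> x"
    proof
      assume "h \<otimes> x \<otimes> d = x"
      then have "h \<otimes> (x \<otimes> d) = x" using h d by (simp add: m_assoc)
      then show False using h d inv_solve_right[of h x "x \<otimes> d"] by simp
    qed
    ultimately have "h \<otimes> x \<in> A" "h \<otimes> x \<otimes> d \<in> A"
      using h d by (auto simp: A_def)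
    then show ?thesis by blast
  next
    case 2
    then show ?thesis
      using d by (intro bexI[of _ d] bexI[of _ \<one>]) (auto simp: A_def)
  next
    case 3
    then have "c (inv d) = 1" using c_inv_eq[of d] d n_ge by simp
    moreover have "inv d \<noteq> x" using d by auto
    ultimately have "inv d \<in> A" using d by (simp add: A_def del: c_inv)
    moreover have "\<one> \<in> A" by (simp add: A_def)
    ultimately show ?thesis using d by (metis l_inv)
  qed
qed

text \<open>The equation rearranges to \<open>b' \<otimes> inv b = inv a' \<otimes> a\<close>, and
  such right-hand sides range exactly over \<open>D\<close>.\<close>

lemma collision_iff:
  assumes "b \<in> carrier G" "b' \<in> carrier G"
  shows "(\<exists>a\<in>A. \<exists>a'\<in>A. a \<otimes> b = a' \<otimes> b') \<longleftrightarrow> b' \<otimes> inv b \<in> D"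
proof
  assume "\<exists>a\<in>A. \<exists>a'\<in>A. a \<otimes> b = a' \<otimes> b'"
  then obtain a a' where a: "a \<in> A" "a' \<in> A" "a \<otimes> b = a' \<otimes> b'" by blast
  then have closed: "a \<in> carrier G" "a' \<in> carrier G" using A_subset by auto
  have "a = a' \<otimes> (b' \<otimes> inv b)"
    using a closed assms by (metis inv_closed inv_solve_right m_assoc m_closed)
  then have "b' \<otimes> inv b = inv a' \<otimes> a"
    using closed assms by (simp add: inv_solve_left)
  then show "b' \<otimes> inv b \<in> D" using inv_mult_in_D a by simp
next
  assume "b' \<otimes> inv b \<in> D"
  then obtain a a' where a: "a \<in> A" "a' \<in> A" "a = a' \<otimes> (b' \<otimes> inv b)"
    using D_connects by blast
  then have "a \<otimes> b = a' \<otimes> b'"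
    using assms A_subset by (auto simp: m_assoc)
  then show "\<exists>a\<in>A. \<exists>a'\<in>A. a \<otimes> b = a' \<otimes> b'" using a by blast
qed

lemma unique_products_A_iff:
  assumes "B \<subseteq> carrier G"
  shows "unique_products G A B \<longleftrightarrow> (\<forall>b\<in>B. \<forall>b'\<in>B. b' \<otimes> inv b \<in> D \<longrightarrow> b = b')"
proof -
  have "b' \<otimes> inv b \<in> D \<longleftrightarrow> (\<exists>a\<in>A. \<exists>a'\<in>A. a \<otimes> b = a' \<otimes> b')" if "b \<in> B" "b' \<in> B" for b b'
    using collision_iff that assms by blast
  then show ?thesis
    unfolding unique_products_iff[OF A_subset assms] by blast
qed

text \<open>Collision is symmetric in \<open>b\<close> and \<open>b'\<close>, which spares a
  computation with inverses in \<open>D\<close>.\<close>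

lemma quotient_in_D_sym:
  assumes "b \<in> carrier G" "b' \<in> carrier G" "b' \<otimes> inv b \<in> D"
  shows "b \<otimes> inv b' \<in> D"
  using assms collision_iff by metis

section \<open>Chains of powers and the large s-factor\<close>

lemma chain_quotient:
  assumes "y \<in> carrier G" "i \<le> (j::nat)"
  shows "(x [^] j \<otimes> y) \<otimes> inv (x [^] i \<otimes> y) = x [^] (j - i)"
proof -
  have "x [^] j \<otimes> y = x [^] (j - i) \<otimes> (x [^] i \<otimes> y)"
    using assms by (simp add: m_assoc[symmetric] nat_pow_mult)
  then show ?thesis
    using assms by (simp add: inv_solve_right')
qed

text \<open>For \<open>i \<le> j\<close> the quotient is the power of \<open>x\<close> with exponent
  \<open>j - i \<le> n - 2\<close>. Exponent 1 gives \<open>x\<close>, which is not in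
  \<open>D\<close>; exponents from 2 to \<open>n - 2\<close> have the wrong coordinate. The bound
  matters, since the power with exponent \<open>n - 1\<close> may lie in \<open>D\<close>.\<close>

lemma chain_independent:
  assumes "y \<in> carrier G" "i \<le> n - 2" "j \<le> n - 2"
    and D: "(x [^] j \<otimes> y) \<otimes> inv (x [^] i \<otimes> y) \<in> D"
  shows "i = (j::nat)"
proof -
  have wlog: "i = j" if "i \<le> j" "j \<le> n - 2" "(x [^] j \<otimes> y) \<otimes> inv (x [^] i \<otimes> y) \<in> D"
    for i j :: nat
  proof -
    have in_D: "x [^] (j - i) \<in> D"
      using that chain_quotient assms(1) by simp
    then have "x [^] (j - i) \<noteq> x" by (simp add: D_def)
    then have "j - i \<noteq> 1" by auto
    moreover have "int (j - i) mod int n = int (j - i)"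
      using that n_ge by simp
    then have "int (j - i) \<in> {0, 1, int n - 1}"
      using in_D c_pow by (auto simp: D_def)
    ultimately show "i = j" using that n_ge by auto
  qed
  show ?thesis
  proof (cases "i \<le> j")
    case True
    then show ?thesis using wlog assms by simp
  next
    case False
    then show ?thesis
      using wlog[of j i] assms quotient_in_D_sym[OF _ _ D] by simp
  qed
qed

lemma large_s_factor:
  assumes "finite (carrier G)"
  obtains C where "right_s_factor G A C" "card C \<ge> n - 1"
proof -
  \<comment> \<open>The factor \<open>\<one>\<close> matches the chain form with
    \<open>y = \<one>\<close>.\<close>
  let ?B = "(\<lambda>i. x [^] i \<otimes> \<one>) ` {..n - 2}"
  have B: "?B \<subseteq> carrier G" by auto
  have inj: "inj_on (\<lambda>i. x [^] i \<otimes> \<one>) {..n - 2}"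
  proof (rule inj_onI)
    fix i j assume ij: "i \<in> {..n - 2}" "j \<in> {..n - 2}" "x [^] i \<otimes> \<one> = x [^] j \<otimes> \<one>"
    then have "x [^] i = x [^] j" by simp
    then have "int i mod int n = int j mod int n" by (metis c_pow)
    then show "i = j" using ij n_ge by simp
  qed
  have "unique_products G A ?B"
    unfolding unique_products_A_iff[OF B] using chain_independent[of \<one>] by blast
  then obtain C where C: "?B \<subseteq> C" "right_s_factor G A C"
    using unique_products_extends_to_s_factor[OF assms _ B] by blast
  then have "finite C"
    using assms by (auto simp: right_s_factor_def intro: finite_subset)
  then have "card ?B \<le> card C" using C card_mono by blast
  moreover have "card ?B = n - 1" using inj n_ge by (simp add: card_image)
  ultimately show thesis using that C by simp
qed

section \<open>The small s-factor\<close>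

lemma small_s_factor:
  obtains B where "right_s_factor G A B" "card B \<le> n - 2"
proof -
  \<comment> \<open>With \<open>a = inv (x [^] n)\<close> the element \<open>\<one>\<close> would
    have no neighbour in \<open>B\<close>; with \<open>a = \<one>\<close> the same would happen to
    \<open>x \<otimes> x\<close>.\<close>
  obtain a where a: "a \<in> carrier G" "c a = 0" "a \<noteq> \<one>" "a \<noteq> inv (x [^] n)"
    using kernel_avoids_two by blast
  define y where "y = a \<otimes> x [^] (3::nat)"
  define z where "z = (\<lambda>i::nat. x [^] i \<otimes> y)"
  \<comment> \<open>As \<open>z i\<close> has coordinate \<open>i + 3\<close>, the set meets the
    cosets 1 and 3 to \<open>n - 1\<close> once each and skips 0 and 2.\<close>
  define B where "B = insert x (z ` {..n - 4})"
  have y [simp]: "y \<in> carrier G" using a by (simp add: y_def)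
  have z [simp]: "z i \<in> carrier G" for i by (simp add: z_def)
  have c_y: "c y = 3" using a n_ge by (simp add: y_def c_pow)
  have c_z: "c (z i) = int i + 3" if "i \<le> n - 4" for i
    using that n_ge c_y by (simp add: z_def c_pow)
  have B: "B \<subseteq> carrier G" by (auto simp: B_def)
  have "unique_products G A B"
    unfolding unique_products_A_iff[OF B]
  proof (intro ballI impI)
    fix b b' assume b: "b \<in> B" "b' \<in> B" "b' \<otimes> inv b \<in> D"
    \<comment> \<open>The quotient has coordinate \<open>i + 2\<close>, which lies between 2 and
      \<open>n - 2\<close>.\<close>
    have apart: "z i \<otimes> inv x \<notin> D" if "i \<le> n - 4" for i
      using that n_ge c_diff[of "z i" x] c_z[OF that] by (auto simp: D_def simp del: c_mult c_inv)
    then have apart': "x \<otimes> inv (z i) \<notin> D" if "i \<le> n - 4" for i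
      using that quotient_in_D_sym[of "z i" x] by auto
    consider "b = x" "b' = x" | i where "b = x" "b' = z i" "i \<le> n - 4"
      | i where "b = z i" "b' = x" "i \<le> n - 4"
      | i j where "b = z i" "b' = z j" "i \<le> n - 4" "j \<le> n - 4"
      using b by (auto simp: B_def)
    then show "b = b'"
    proof cases
      case 4
      then have "i = j" using b chain_independent[of y i j] by (simp add: z_def)
      with 4 show ?thesis by simp
    qed (use b apart apart' in auto)
  qed
  moreover have "\<exists>b\<in>B. \<exists>a\<in>A. \<exists>a'\<in>A. a \<otimes> b = a' \<otimes> g" if g: "g \<in> carrier G" for g
  proof -
    have x_in: "x \<in> B" and z_in: "\<And>i. i \<le> n - 4 \<Longrightarrow> z i \<in> B" by (auto simp: B_def)
    have "\<exists>b\<in>B. g \<otimes> inv b \<in> D"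
    proof -
      have neq: "d \<noteq> x \<and> d \<noteq> inv x" if "c d = 0" for d
        using neq_x[OF that] neq_inv_x[OF that] n_ge by simp
      \<comment> \<open>If the coset of \<open>g\<close> meets \<open>B\<close>, a quotient of
        coordinate 0 settles the case. Cosets 0 and 2 need a neighbour from an adjacent
        coset.\<close>
      consider "c g = 0" | "c g = 1" | "c g = 2" | "c g \<ge> 3"
        using c_range[OF g] by linarith
      then show ?thesis
      proof cases
        case 1
        show ?thesis
        proof (cases "g = \<one>")
          case True
          \<comment> \<open>In coset 0 only \<open>\<one>\<close> is not adjacent to
            \<open>x\<close>. The end of the chain, in coset \<open>n - 1\<close>, takes
            over.\<close>
          let ?b = "z (n - 4)"
          have cd: "c (g \<otimes> inv ?b) = 1"
            using c_diff[OF g z, of "n - 4"] c_z[of "n - 4"] 1 n_ge by simp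
          have "inv ?b \<noteq> x"
          proof
            assume "inv ?b = x"
            then have "?b \<otimes> x = \<one>" using r_inv[OF z] by metis
            moreover have "x [^] (4::nat) = x [^] (3::nat) \<otimes> x"
              using nat_pow_Suc[of x 3] by simp
            ultimately have "x [^] (n - 4) \<otimes> (a \<otimes> x [^] (4::nat)) = \<one>"
              using a by (simp add: z_def y_def m_assoc)
            \<comment> \<open>\<open>a\<close> and \<open>x\<close> need not commute, but a product
              equal to \<open>\<one>\<close> may be rotated, which collects the powers of
              \<open>x\<close>.\<close>
            then have "(a \<otimes> x [^] (4::nat)) \<otimes> x [^] (n - 4) = \<one>"
              by (rule inv_comm) (use a in auto)
            then have "a \<otimes> x [^] n = \<one>"
              using a n_ge by (simp add: m_assoc nat_pow_mult)
            then show False using a inv_equality[of a "x [^] n"] by simp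
          qed
          then have "g \<otimes> inv ?b \<noteq> x" using True by simp
          moreover have "g \<otimes> inv ?b \<noteq> inv x" by (rule neq_inv_x[OF cd]) (use n_ge in simp)
          ultimately have "g \<otimes> inv ?b \<in> D"
            using cd g by (simp add: D_def del: c_mult c_inv)
          then show ?thesis using z_in[of "n - 4"] by auto
        next
          case False
          have cd: "c (g \<otimes> inv x) = int n - 1"
            using c_diff[OF g x_closed] 1 by simp
          moreover have "g \<otimes> inv x \<noteq> x" by (rule neq_x[OF cd]) (use n_ge in simp)
          moreover have "g \<otimes> inv x \<noteq> inv x" using False g by simp
          ultimately have "g \<otimes> inv x \<in> D"
            using g by (simp add: D_def del: c_mult c_inv)
          then show ?thesis using x_in by blast
        qed
      next
        case 2
        then have "c (g \<otimes> inv x) = 0" using c_diff[OF g x_closed] by simp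
        then have "g \<otimes> inv x \<in> D"
          using g neq[of "g \<otimes> inv x"] by (simp add: D_def del: c_mult c_inv)
        then show ?thesis using x_in by blast
      next
        case 3
        show ?thesis
        proof (cases "g \<otimes> inv x = x")
          case True
          \<comment> \<open>This is the one element of coset 2 not adjacent to \<open>x\<close>. It
            is adjacent to the chain start \<open>y\<close>, since otherwise
            \<open>x \<otimes> g = y\<close>, forcing \<open>a = \<one>\<close>.\<close>
          then have g_eq: "g = x \<otimes> x" using g by (simp add: inv_solve_right')
          have cd: "c (g \<otimes> inv y) = int n - 1"
            using c_diff[OF g y] c_y 3 by simp
          have "g \<otimes> inv y \<noteq> inv x"
          proof
            assume "g \<otimes> inv y = inv x"
            then have "g = inv x \<otimes> y" using g by (simp add: inv_solve_right')
            then have "x \<otimes> g = y" using g by (simp add: inv_solve_left)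
            then have "x [^] (3::nat) = a \<otimes> x [^] (3::nat)"
              by (simp add: y_def g_eq numeral_eq_Suc m_assoc)
            then show False using a by simp
          qed
          moreover have "g \<otimes> inv y \<noteq> x" by (rule neq_x[OF cd]) (use n_ge in simp)
          ultimately have "g \<otimes> inv y \<in> D"
            using cd g by (simp add: D_def del: c_mult c_inv)
          moreover have "y \<in> B" using z_in[of 0] by (simp add: z_def)
          ultimately show ?thesis by blast
        next
          case False
          have cd: "c (g \<otimes> inv x) = 1" using c_diff[OF g x_closed] 3 by simp
          have "g \<otimes> inv x \<noteq> inv x" by (rule neq_inv_x[OF cd]) (use n_ge in simp)
          with False cd have "g \<otimes> inv x \<in> D"
            using g by (simp add: D_def del: c_mult c_inv)
          then show ?thesis using x_in by blast
        qed
      next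
        case 4
        define i where "i = nat (c g - 3)"
        have i: "i \<le> n - 4" using c_range[OF g] 4 by (simp add: i_def)
        have "c (g \<otimes> inv (z i)) = 0"
          using c_diff[OF g z, of i] c_z[OF i] 4 by (simp add: i_def)
        then have "g \<otimes> inv (z i) \<in> D"
          using g neq[of "g \<otimes> inv (z i)"] by (simp add: D_def del: c_mult c_inv)
        then show ?thesis using z_in[OF i] by blast
      qed
    qed
    then obtain b where "b \<in> B" "g \<otimes> inv b \<in> D" by blast
    moreover from this have "b \<in> carrier G" using B by blast
    ultimately show ?thesis using collision_iff[of b g] g by blast
  qed
  ultimately have "right_s_factor G A B"
    using right_s_factorI[OF A_subset _ B] by (simp add: B_def)
  moreover have "card B \<le> n - 2"
  proof -
    have "card B \<le> Suc (card (z ` {..n - 4}))"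
      unfolding B_def by (simp add: card_insert_if)
    also have "\<dots> \<le> Suc (n - 3)"
      using card_image_le[of "{..n - 4}" z] n_ge by simp
    finally show ?thesis using n_ge by simp
  qed
  ultimately show thesis using that by blast
qed

section \<open>Comparison of the two s-factors\<close>

lemma not_right_stable:
  assumes "finite (carrier G)"
  shows "\<not> right_stable_group G"
proof -
  obtain C where C: "right_s_factor G A C" "card C \<ge> n - 1"
    using large_s_factor[OF assms] .
  obtain B where B: "right_s_factor G A B" "card B \<le> n - 2"
    using small_s_factor .
  show ?thesis
  proof (rule not_right_stable_groupI)
    show "card B < card C" using B C n_ge by linarith
  qed (use assms A_subset B C in \<open>auto simp: A_def\<close>)
qed

end

theorem lemma6:
  fixes G :: "('a, 'b) monoid_scheme" and H :: "'a set" and n :: nat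
  assumes "group G"
    and "finite (carrier G)"
    and "H \<lhd> G"
    and "cyclic_group (G Mod H)"
    and "order (G Mod H) = n"
    and "n \<ge> 4"
    and "card H \<ge> 3"
  shows "\<not> right_stable_group G"
proof -
  interpret group G by fact
  obtain c x where "c \<in> hom G (integer_mod_group n)" "kernel G (integer_mod_group n) c = H"
    "x \<in> carrier G" "c x = 1 mod int n"
    using cyclic_quotient_coordinate[of H n] assms by auto
  \<comment> \<open>Since \<open>n \<ge> 4\<close>, the residue \<open>1 mod int n\<close> is
    1.\<close>
  then interpret cyclic_coordinate G n c x
    using assms by unfold_locales auto
  show ?thesis using not_right_stable assms(2) .
qed

end
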